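(* The chromatic number of the plane is at least $5$. That is, there exists a finite set $P\subset\mathbb{R}^2$ whose unit-distance graph is not $4$-colourable; consequently, for every colouring of $\mathbb{R}^2$ with $4$ colours, there are two points at Euclidean distance exactly $1$ that receive the same colour.
   Context: For a set $P\subset\mathbb{R}^2$, the unit-distance graph on $P$ is the graph with vertex set $P$ in which two points are adjacent if and only if their Euclidean distance is exactly $1$. A $k$-colouring of a graph is a map from its vertex set to a set of $k$ colours such that adjacent vertices receive different colours. The chromatic number of the plane is the least $k$ such that $\mathbb{R}^2$ can be coloured with $k$ colours with no two points at distance exactly $1$ receiving the same colour. *)

theory Defs
  imports "HOL-Analysis.Analysis"
begin

definition unit_dist_colouring :: "(real^2) set \<Rightarrow> nat \<Rightarrow> (real^2 \<Rightarrow> nat) \<Rightarrow> bool" where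
  "unit_dist_colouring P k c \<longleftrightarrow>
     (\<forall>p\<in>P. c p < k) \<and> (\<forall>p\<in>P. \<forall>q\<in>P. dist p q = 1 \<longrightarrow> c p \<noteq> c q)"

definition unit_dist_colourable :: "(real^2) set \<Rightarrow> nat \<Rightarrow> bool" where
  "unit_dist_colourable P k \<longleftrightarrow> (\<exists>c. unit_dist_colouring P k c)"

end

theory Submission
  imports Defs
begin

text \<open>By compactness (de Bruijn--Erdos) it suffices to refute 4-colourings of the whole plane, which
  allows every local argument to be moved around by isometries. Following de Grey, look at a triple: three
  alternate neighbours of the centre of a unit hexagon.

  If no triple is monochromatic, a 31-point piece of the triangular lattice restricts the colours of
  the six points at distance 2 in lattice directions from its centre. Rotating the piece about its
  centre so that these points move by distance 1 leaves only colourings in which opposite ones agree.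
  So any two points at distance 4 have the same colour, which an isosceles triangle with
  sides 4, 4, 1 contradicts.

  A monochromatic triple is impossible as well: some two of the other three vertices of the
  hexagon share a colour, and a hexagon coloured in this way does not extend to a certain set of 229 points
  with coordinates in the field generated by the square roots of 3 and 11.\<close>

section \<open>Compactness: from finite sets to the plane\<close>

text \<open>By Tychonoff the maps into \<open>k\<close> colours form a compact space. Each unit pair
  \<open>e\<close> cuts out a closed set \<open>R e\<close>, and the hypothesis makes any finitely
  many of these sets meet.\<close>

lemma unit_dist_colourable_compactness:
  assumes fin: "\<And>P. finite P \<Longrightarrow> unit_dist_colourable P k"
  shows "unit_dist_colourable UNIV k"
proof -
  define X where "X = product_topology (\<lambda>_ :: real^2. discrete_topology {..<k}) UNIV"
  define R where "R e = {c \<in> topspace X. c (fst e) \<noteq> c (snd e)}" for e :: "(real^2) \<times> (real^2)"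
  define E where "E = {e :: (real^2) \<times> (real^2). dist (fst e) (snd e) = 1}"
  have topX: "topspace X = {c. \<forall>x. c x < k}"
    by (auto simp: X_def PiE_def Pi_def)
  have proj: "closedin X {c \<in> topspace X. Q (c x)}" for x and Q :: "nat \<Rightarrow> bool"
  proof -
    have "continuous_map X (discrete_topology {..<k}) (\<lambda>c. c x)"
      unfolding X_def by (rule continuous_map_product_projection) simp
    hence "closedin X {c \<in> topspace X. c x \<in> {i. i < k \<and> Q i}}"
      by (rule closedin_continuous_map_preimage) auto
    also have "{c \<in> topspace X. c x \<in> {i. i < k \<and> Q i}} = {c \<in> topspace X. Q (c x)}"
      by (auto simp: topX)
    finally show ?thesis .
  qed
  have closed: "closedin X (R e)" for e
  proof -
    \<comment> \<open>Splitting by the colour of the first end gives a finite union of conditions on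
      single coordinates.\<close>
    have "R e = (\<Union>i<k. {c \<in> topspace X. c (fst e) = i} \<inter> {c \<in> topspace X. c (snd e) \<noteq> i})"
      by (auto simp: R_def topX)
    also have "closedin X \<dots>"
      by (intro closedin_Union) (auto intro!: closedin_Int proj)
    finally show ?thesis .
  qed
  have fip: "\<Inter>\<F> \<noteq> {}" if \<F>: "finite \<F>" "\<F> \<subseteq> R ` E" for \<F>
  proof -
    obtain D where D: "finite D" "D \<subseteq> E" "\<F> = R ` D"
      using finite_subset_image[OF \<F>] by blast
    have "finite (fst ` D \<union> snd ` D)"
      using D by simp
    from fin[OF this] obtain c where c: "unit_dist_colouring (fst ` D \<union> snd ` D) k c"
      by (auto simp: unit_dist_colourable_def)
    \<comment> \<open>Points outside the finite set get the default colour 0, which is a legal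
      colour only if \<open>k\<close> is positive.\<close>
    have "0 < k" if "D \<noteq> {}"
      using c that by (auto simp: unit_dist_colouring_def)
    hence "(\<lambda>x. if x \<in> fst ` D \<union> snd ` D then c x else 0) \<in> R e" if "e \<in> D" for e
      using c that D by (auto simp: R_def topX unit_dist_colouring_def E_def)
    thus ?thesis
      unfolding D by blast
  qed
  have "compact_space X"
    unfolding X_def by (simp add: compact_space_product_topology compact_space_discrete_topology)
  hence "\<Inter>(R ` E) \<noteq> {}"
    using closed fip unfolding compact_space_fip by (smt (verit, best) imageE)
  then obtain c where c: "\<And>e. e \<in> E \<Longrightarrow> c \<in> R e"
    by blast
  have "c x < k" for x
    using c[of "(x, x + axis 1 1)"] by (simp add: E_def R_def topX dist_norm)
  moreover have "c x \<noteq> c y" if "dist x y = 1" for x y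
    using c[of "(x, y)"] that by (simp add: E_def R_def)
  ultimately show ?thesis
    unfolding unit_dist_colourable_def unit_dist_colouring_def by blast
qed

section \<open>Colourings of the complex plane and monochromatic triples\<close>

definition proper4 :: "(complex \<Rightarrow> nat) \<Rightarrow> bool" where
  "proper4 f \<longleftrightarrow> (\<forall>z. f z < 4) \<and> (\<forall>z w. cmod (z - w) = 1 \<longrightarrow> f z \<noteq> f w)"

definition \<omega> :: complex where
  "\<omega> = Complex (1/2) (sqrt 3 / 2)"

text \<open>As \<open>\<omega> - 1\<close> and \<open>- \<omega>\<close> are the second and fourth
  powers of the sixth root of unity \<open>\<omega>\<close>, the points form an equilateral triangle
  centred at \<open>p\<close>.\<close>

definition mono_triple :: "(complex \<Rightarrow> nat) \<Rightarrow> complex \<Rightarrow> complex \<Rightarrow> bool" where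
  "mono_triple f p u \<longleftrightarrow> f (p + u) = f (p + u * (\<omega> - 1)) \<and> f (p + u) = f (p - u * \<omega>)"

lemma omega_square: "\<omega> * \<omega> = \<omega> - 1"
  by (simp add: \<omega>_def complex_eq_iff)

lemma cmod_omega: "cmod \<omega> = 1" "cmod (\<omega> - 1) = 1" "cmod (1 - \<omega>) = 1"
  by (simp_all add: \<omega>_def cmod_def power2_eq_square)

lemma fourth_colour:
  fixes a b c :: nat
  assumes "a < 4" "b < 4" "c < 4" "a \<noteq> b" "a \<noteq> c" "b \<noteq> c"
  obtains d where "\<And>i. i < 4 \<Longrightarrow> i = a \<or> i = b \<or> i = c \<or> i = d"
proof -
  have "card ({..<4} - {a, b, c}) = 1"
    using assms by (subst card_Diff_subset) auto
  then obtain d where "{..<4} - {a, b, c} = {d}"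
    by (auto simp: card_1_singleton_iff)
  hence "i = a \<or> i = b \<or> i = c \<or> i = d" if "i < 4" for i
    using that by blast
  thus ?thesis
    using that by blast
qed

text \<open>The next definitions spell out colour constraints as clauses whose only atoms say that
  a vertex has a given colour, so that the SAT solver needs no reasoning about equality.\<close>

definition palette :: "nat \<Rightarrow> nat \<Rightarrow> nat \<Rightarrow> nat \<Rightarrow> nat \<Rightarrow> bool" where
  "palette k0 k1 k2 k3 i \<longleftrightarrow> i = k0 \<or> i = k1 \<or> i = k2 \<or> i = k3"

definition apart :: "nat \<Rightarrow> nat \<Rightarrow> nat \<Rightarrow> nat \<Rightarrow> nat \<Rightarrow> nat \<Rightarrow> bool" where
  "apart k0 k1 k2 k3 i j \<longleftrightarrow>
     \<not> (i = k0 \<and> j = k0) \<and> \<not> (i = k1 \<and> j = k1) \<and> \<not> (i = k2 \<and> j = k2) \<and> \<not> (i = k3 \<and> j = k3)"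

lemma apartI: "i \<noteq> j \<Longrightarrow> apart k0 k1 k2 k3 i j"
  by (auto simp: apart_def)

definition apart3 :: "nat \<Rightarrow> nat \<Rightarrow> nat \<Rightarrow> nat \<Rightarrow> nat \<Rightarrow> nat \<Rightarrow> nat \<Rightarrow> bool" where
  "apart3 k0 k1 k2 k3 i j l \<longleftrightarrow>
     \<not> (i = k0 \<and> j = k0 \<and> l = k0) \<and> \<not> (i = k1 \<and> j = k1 \<and> l = k1) \<and>
     \<not> (i = k2 \<and> j = k2 \<and> l = k2) \<and> \<not> (i = k3 \<and> j = k3 \<and> l = k3)"

lemma apart3I: "\<not> (i = j \<and> i = l) \<Longrightarrow> apart3 k0 k1 k2 k3 i j l"
  by (auto simp: apart3_def)

section \<open>Colourings of a piece of the triangular lattice\<close>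

text \<open>Entry \<open>(x, y)\<close> stands for the lattice point \<open>x + y * \<omega>\<close>, of squared norm \<open>x\<^sup>2 + x * y + y\<^sup>2 \<le> 7\<close>.\<close>

definition lattice_disc :: "(int \<times> int) list" where
  "lattice_disc =
     [(0, 0), (1, 0), (0, 1), (-1, 1), (-1, 0), (0, -1), (1, -1),
      (1, 1), (-1, 2), (-2, 1), (-1, -1), (1, -2), (2, -1),
      (2, 0), (0, 2), (-2, 2), (-2, 0), (0, -2), (2, -2),
      (2, 1), (1, 2), (-1, 3), (-2, 3), (-3, 2), (-3, 1),
      (-2, -1), (-1, -2), (1, -3), (2, -3), (3, -2), (3, -1)]"

text \<open>A propositional check on 31 points. \<open>t1\<close> and \<open>t2\<close> exclude the
  two orientations of a triple. The disjuncts with four conjuncts are the six runs of four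
  consecutive points among those at distance 2; the second conclusion concerns one such run.\<close>

lemma lattice_disc_colouring:
  fixes g :: "int \<Rightarrow> int \<Rightarrow> nat"
  assumes col: "\<And>x y. g x y < 4"
    and e1: "\<And>x y. g x y \<noteq> g (x + 1) y"
    and e2: "\<And>x y. g x y \<noteq> g x (y + 1)"
    and e3: "\<And>x y. g x y \<noteq> g (x - 1) (y + 1)"
    and t1: "\<And>x y. \<not> (g (x + 1) y = g (x - 1) (y + 1) \<and> g (x + 1) y = g x (y - 1))"
    and t2: "\<And>x y. \<not> (g (x - 1) y = g (x + 1) (y - 1) \<and> g (x - 1) y = g x (y + 1))"
  defines "l \<equiv> \<lambda>x y. g x y = g 0 0"
  shows "g 2 0 = g (-2) 0 \<or>
           l 2 0 \<and> l 0 2 \<and> l (-2) 2 \<and> l (-2) 0 \<or> l 0 2 \<and> l (-2) 2 \<and> l (-2) 0 \<and> l 0 (-2) \<or>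
           l (-2) 2 \<and> l (-2) 0 \<and> l 0 (-2) \<and> l 2 (-2) \<or> l (-2) 0 \<and> l 0 (-2) \<and> l 2 (-2) \<and> l 2 0 \<or>
           l 0 (-2) \<and> l 2 (-2) \<and> l 2 0 \<and> l 0 2 \<or> l 2 (-2) \<and> l 2 0 \<and> l 0 2 \<and> l (-2) 2" (is ?A)
    and "l 2 0 \<or> l 0 2 \<or> l (-2) 2 \<or> l (-2) 0" (is ?B)
proof -
  \<comment> \<open>The triangle 0, 1, \<open>\<omega>\<close> shows three colours; naming them
    removes the symmetry under permuting colours.\<close>
  have "g 0 0 \<noteq> g 1 0" "g 0 0 \<noteq> g 0 1" "g 1 0 \<noteq> g 0 1"
    using e1[of 0 0] e2[of 0 0] e3[of 1 0] by simp_all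
  from fourth_colour[OF col col col this]
  obtain k3 where k3: "\<And>i. i < 4 \<Longrightarrow> i = g 0 0 \<or> i = g 1 0 \<or> i = g 0 1 \<or> i = k3"
    by blast
  define k0 k1 k2 where "k0 = g 0 0" and "k1 = g 1 0" and "k2 = g 0 1"
  have c: "list_all (\<lambda>(x, y). palette k0 k1 k2 k3 (g x y)) lattice_disc"
    using k3[OF col] by (simp add: list_all_iff palette_def k0_def k1_def k2_def)
  have e: "list_all (\<lambda>(x, y). apart k0 k1 k2 k3 (g x y) (g (x + 1) y) \<and>
      apart k0 k1 k2 k3 (g x y) (g x (y + 1)) \<and> apart k0 k1 k2 k3 (g x y) (g (x - 1) (y + 1))) lattice_disc"
    by (simp add: list_all_iff split_def apartI e1 e2 e3)
  have t: "list_all (\<lambda>(x, y). apart3 k0 k1 k2 k3 (g (x + 1) y) (g (x - 1) (y + 1)) (g x (y - 1)) \<and>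
      apart3 k0 k1 k2 k3 (g (x - 1) y) (g (x + 1) (y - 1)) (g x (y + 1))) lattice_disc"
    by (simp add: list_all_iff split_def apart3I t1 t2)
  note f1 = c[unfolded lattice_disc_def, simplified, unfolded palette_def]
  note f2 = e[unfolded lattice_disc_def, simplified, unfolded apart_def]
  note f3 = t[unfolded lattice_disc_def, simplified, unfolded apart3_def]
  note facts = f1 f2 f3 k0_def[symmetric] k1_def[symmetric] k2_def[symmetric]
  let ?six = "g 2 0 = k0 \<and> g 0 2 = k0 \<and> g (-2) 2 = k0 \<and> g (-2) 0 = k0 \<or>
    g 0 2 = k0 \<and> g (-2) 2 = k0 \<and> g (-2) 0 = k0 \<and> g 0 (-2) = k0 \<or>
    g (-2) 2 = k0 \<and> g (-2) 0 = k0 \<and> g 0 (-2) = k0 \<and> g 2 (-2) = k0 \<or>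
    g (-2) 0 = k0 \<and> g 0 (-2) = k0 \<and> g 2 (-2) = k0 \<and> g 2 0 = k0 \<or>
    g 0 (-2) = k0 \<and> g 2 (-2) = k0 \<and> g 2 0 = k0 \<and> g 0 2 = k0 \<or>
    g 2 (-2) = k0 \<and> g 2 0 = k0 \<and> g 0 2 = k0 \<and> g (-2) 2 = k0"
  \<comment> \<open>Equality of two colours is split by colour to stay within the atoms known to
    \<open>sat\<close>.\<close>
  have "g 2 0 = k0 \<and> g (-2) 0 = k0 \<or> g 2 0 = k1 \<and> g (-2) 0 = k1 \<or>
      g 2 0 = k2 \<and> g (-2) 0 = k2 \<or> g 2 0 = k3 \<and> g (-2) 0 = k3 \<or> ?six"
    using facts by sat
  hence "g 2 0 = g (-2) 0 \<or> ?six"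
    by (elim disjE conjE) simp_all
  thus ?A
    unfolding l_def k0_def .
  show ?B
    unfolding l_def k0_def[symmetric] using facts by sat
qed

section \<open>Rotating the lattice piece\<close>

lemma proper4_isometry:
  assumes "proper4 f" "cmod u = 1" "cmod (z - w) = 1"
  shows "f (p + u * z) \<noteq> f (p + u * w)"
proof -
  have "cmod ((p + u * z) - (p + u * w)) = cmod u * cmod (z - w)"
    by (simp flip: norm_mult add: algebra_simps)
  with assms show ?thesis
    by (auto simp: proper4_def)
qed

text \<open>With the factor 2, the sixth roots of unity label the six lattice points at distance 2
  from the centre.\<close>

definition linked :: "(complex \<Rightarrow> nat) \<Rightarrow> complex \<Rightarrow> complex \<Rightarrow> complex \<Rightarrow> bool" where
  "linked f p u z \<longleftrightarrow> f (p + u * (2 * z)) = f p"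

lemma linking_vertices:
  fixes p u :: complex
  assumes f: "proper4 f" and no_triple: "\<And>p u. cmod u = 1 \<Longrightarrow> \<not> mono_triple f p u" and u: "cmod u = 1"
  shows "f (p + u * 2) = f (p - u * 2) \<or>
      linked f p u 1 \<and> linked f p u \<omega> \<and> linked f p u (\<omega> - 1) \<and> linked f p u (-1) \<or>
      linked f p u \<omega> \<and> linked f p u (\<omega> - 1) \<and> linked f p u (-1) \<and> linked f p u (- \<omega>) \<or>
      linked f p u (\<omega> - 1) \<and> linked f p u (-1) \<and> linked f p u (- \<omega>) \<and> linked f p u (1 - \<omega>) \<or>
      linked f p u (-1) \<and> linked f p u (- \<omega>) \<and> linked f p u (1 - \<omega>) \<and> linked f p u 1 \<or>
      linked f p u (- \<omega>) \<and> linked f p u (1 - \<omega>) \<and> linked f p u 1 \<and> linked f p u \<omega> \<or>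
      linked f p u (1 - \<omega>) \<and> linked f p u 1 \<and> linked f p u \<omega> \<and> linked f p u (\<omega> - 1)" (is ?A)
    and "linked f p u 1 \<or> linked f p u \<omega> \<or> linked f p u (\<omega> - 1) \<or> linked f p u (-1)" (is ?B)
proof -
  define g where "g x y = f (p + u * (of_int x + of_int y * \<omega>))" for x y :: int
  have col: "g x y < 4" for x y
    using f by (simp add: g_def proper4_def)
  have e1: "g x y \<noteq> g (x + 1) y" for x y
    unfolding g_def by (rule proper4_isometry[OF f u]) simp
  have e2: "g x y \<noteq> g x (y + 1)" for x y
    unfolding g_def by (rule proper4_isometry[OF f u]) (simp add: algebra_simps cmod_omega)
  have e3: "g x y \<noteq> g (x - 1) (y + 1)" for x y
    unfolding g_def by (rule proper4_isometry[OF f u]) (simp add: algebra_simps cmod_omega)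
  have t1: "\<not> (g (x + 1) y = g (x - 1) (y + 1) \<and> g (x + 1) y = g x (y - 1))" for x y
    using no_triple[OF u, of "p + u * (of_int x + of_int y * \<omega>)"]
    by (simp add: mono_triple_def g_def algebra_simps)
  \<comment> \<open>The other orientation is the triple in direction \<open>-u\<close>.\<close>
  have t2: "\<not> (g (x - 1) y = g (x + 1) (y - 1) \<and> g (x - 1) y = g x (y + 1))" for x y
    using no_triple[of "-u" "p + u * (of_int x + of_int y * \<omega>)"] u
    by (simp add: mono_triple_def g_def algebra_simps)
  have links: "g 2 0 = g 0 0 \<longleftrightarrow> linked f p u 1" "g 0 2 = g 0 0 \<longleftrightarrow> linked f p u \<omega>"
    "g (-2) 2 = g 0 0 \<longleftrightarrow> linked f p u (\<omega> - 1)" "g (-2) 0 = g 0 0 \<longleftrightarrow> linked f p u (-1)"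
    "g 0 (-2) = g 0 0 \<longleftrightarrow> linked f p u (- \<omega>)" "g 2 (-2) = g 0 0 \<longleftrightarrow> linked f p u (1 - \<omega>)"
    by (simp_all add: g_def linked_def algebra_simps)
  have "g 2 0 = f (p + u * 2)" "g (-2) 0 = f (p - u * 2)"
    by (simp_all add: g_def)
  thus ?A
    using lattice_disc_colouring(1)[of g, OF col e1 e2 e3 t1 t2] unfolding links by (simp only:)
  show ?B
    using lattice_disc_colouring(2)[of g, OF col e1 e2 e3 t1 t2] unfolding links .
qed

text \<open>Otherwise a run of four points at distance 2 has the centre's colour. In the rotated
  piece some point of the corresponding run has it too, yet that point is at distance 1 from its
  original.\<close>

lemma opposite_linking_vertices:
  assumes f: "proper4 f" and no_triple: "\<And>p u. cmod u = 1 \<Longrightarrow> \<not> mono_triple f p u" and u: "cmod u = 1"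
  shows "f (p + u * 2) = f (p - u * 2)"
proof (rule ccontr)
  assume neq: "f (p + u * 2) \<noteq> f (p - u * 2)"
  \<comment> \<open>The rotation by \<open>v\<close> moves points at distance 2 from its centre by distance 1.\<close>
  define v where "v = Complex (7/8) (sqrt 15 / 8)"
  have v: "cmod v = 1" "cmod (2 - 2 * v) = 1"
    by (simp_all add: v_def cmod_def power_divide complex_eq_iff power2_eq_square)
  have clash: "\<not> (linked f p u z \<and> linked f p (u * v) z)" if "cmod z = 1" for z
  proof -
    have "2 * z - v * (2 * z) = z * (2 - 2 * v)"
      by (simp add: algebra_simps)
    hence "cmod (2 * z - v * (2 * z)) = 1"
      by (simp only: norm_mult v that mult_1)
    from proper4_isometry[OF f u this, of p] show ?thesis
      by (simp add: linked_def mult.assoc)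
  qed
  \<comment> \<open>Taking \<open>u * v * z\<close> as the direction makes the run of four start at
    \<open>z\<close>.\<close>
  have some: "linked f p (u * v) z \<or> linked f p (u * v) (z * \<omega>) \<or>
      linked f p (u * v) (z * (\<omega> - 1)) \<or> linked f p (u * v) (- z)" if "cmod z = 1" for z
  proof -
    have "cmod (u * v * z) = 1"
      by (simp add: norm_mult u v that)
    from linking_vertices(2)[OF f no_triple this, of p]
    have "linked f p (u * v * z) 1 \<or> linked f p (u * v * z) \<omega> \<or>
        linked f p (u * v * z) (\<omega> - 1) \<or> linked f p (u * v * z) (-1)" .
    moreover have "linked f p (u * v * z) w \<longleftrightarrow> linked f p (u * v) (z * w)" for w
      by (simp add: linked_def mult_ac)
    ultimately show ?thesis
      by simp
  qed
  have no: "\<not> (linked f p u z \<and> linked f p u (z * \<omega>) \<and> linked f p u (z * (\<omega> - 1)) \<and> linked f p u (- z))"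
    if "cmod z = 1" for z
    using some[OF that] clash[OF that] clash[of "z * \<omega>"] clash[of "z * (\<omega> - 1)"] clash[of "- z"]
    by (simp add: norm_mult cmod_omega that) blast
  have rot: "\<omega> * (\<omega> - 1) = -1" "(\<omega> - 1) * \<omega> = -1" "(\<omega> - 1) * (\<omega> - 1) = - \<omega>"
    "(1 - \<omega>) * \<omega> = 1" "(1 - \<omega>) * (\<omega> - 1) = \<omega>"
    by (simp_all add: algebra_simps omega_square)
  show False
    using linking_vertices(1)[OF f no_triple u, of p] neq
      no[of 1] no[of \<omega>] no[of "\<omega> - 1"] no[of "-1"] no[of "- \<omega>"] no[of "1 - \<omega>"]
    by (simp add: cmod_omega omega_square rot) blast
qed

lemma exists_mono_triple:
  assumes f: "proper4 f"
  shows "\<exists>p u. cmod u = 1 \<and> mono_triple f p u"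
proof (rule ccontr)
  assume "\<not> ?thesis"
  hence opp: "f (p + u * 2) = f (p - u * 2)" if "cmod u = 1" for p u
    using opposite_linking_vertices[OF f _ that] by blast
  have four: "f (4 * u) = f 0" if "cmod u = 1" for u
    \<comment> \<open>About the centre \<open>2 * u\<close>, the points \<open>4 * u\<close> and 0
      are opposite.\<close>
    using opp[OF that, of "2 * u"] by (simp add: mult.commute)
  \<comment> \<open>This rotation moves points at distance 4 from its centre by distance 1.\<close>
  define v where "v = Complex (31/32) (sqrt 63 / 32)"
  have v: "cmod v = 1" "cmod (4 * 1 - 4 * v) = 1"
    by (simp_all add: v_def cmod_def power_divide complex_eq_iff power2_eq_square)
  from v(2) have "f (4 * 1) \<noteq> f (4 * v)"
    using f by (simp add: proper4_def)
  with four[OF v(1)] four[of 1] show False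
    by simp
qed

section \<open>A finite set over the square roots of 3 and 11\<close>

text \<open>Integer coordinates over the common denominator 12 turn translations into integer
  additions.\<close>

definition field_point :: "int \<Rightarrow> int \<Rightarrow> int \<Rightarrow> int \<Rightarrow> complex" where
  "field_point a b c d = Complex ((a + b * sqrt 33) / 12) ((c * sqrt 3 + d * sqrt 11) / 12)"

text \<open>The hypotheses fix the rational part and the \<open>sqrt 33\<close> part of 144 times
  the squared norm.\<close>

lemma cmod_field_point:
  assumes "a * a + 33 * (b * b) + 3 * (c * c) + 11 * (d * d) = 144" "a * b + c * d = 0"
  shows "cmod (field_point a b c d) = 1"
proof -
  have s: "sqrt 33 = sqrt 3 * sqrt 11"
    by (simp flip: real_sqrt_mult)
  have "(a + b * sqrt 33)\<^sup>2 + (c * sqrt 3 + d * sqrt 11)\<^sup>2 =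
      (a * a + 33 * (b * b) + 3 * (c * c) + 11 * (d * d)) + 2 * sqrt 33 * (a * b + c * d)"
    unfolding s by (simp add: power2_eq_square algebra_simps)
  also have "\<dots> = 144"
    unfolding assms by simp
  finally show ?thesis
    by (simp add: field_point_def cmod_def power_divide flip: add_divide_distrib)
qed

text \<open>One from each opposite pair of the 30 nonzero vectors of the set V described below, so
  that an edge is listed at one end only.\<close>

definition unit_vectors :: "(int \<times> int \<times> int \<times> int) list" where
  "unit_vectors =
     [(6, 0, 6, 0), (12, 0, 0, 0), (6, 0, -6, 0), (3, -1, 1, 3), (0, 2, -2, 0),
      (3, 1, -1, 3), (3, 1, 1, -3), (0, 2, 2, 0), (3, -1, -1, -3), (10, 0, 0, -2),
      (5, -1, -5, -1), (5, 1, 5, -1), (5, 1, -5, 1), (10, 0, 0, 2), (5, -1, 5, 1)]"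

text \<open>A computer-found subset of \<open>V + V + H\<close>, in the coordinates of \<^const>\<open>field_point\<close>, where \<open>H\<close> is
  the unit hexagon with its centre and \<open>V\<close>, as in de Grey's paper, consists of the origin and the rotations
  of \<open>H - {0}\<close> by \<open>k/2\<close> times the Moser spindle angle \<open>arccos (5/6)\<close> for \<open>-2 \<le> k \<le> 2\<close>.
  The last component of an entry lists the indices of the \<^const>\<open>unit_vectors\<close> that lead from the
  point to another point of the subset.\<close>

definition wheel_core :: "(int \<times> int \<times> int \<times> int \<times> nat list) list" where
  "wheel_core =
     [(-18, 0, 2, 0, [0, 1, 5, 6, 8, 9, 13]), (-15, -1, -5, 3, [0, 1, 9, 11]),
      (-15, -1, 1, -3, [0, 1, 3, 4, 5, 7, 13]), (-15, -1, 5, -3, [1, 2, 4, 5, 12, 13]),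
      (-15, 1, -1, -3, [0, 1, 2, 3, 5, 14]), (-15, 1, 1, 3, [0, 1, 2, 6, 8, 9]),
      (-15, 1, 3, -3, [1, 2, 3, 5, 13]), (-14, 0, 0, -2, [0, 1, 3, 4, 5, 9, 11]),
      (-14, 2, -2, -2, [0, 1, 3, 10]), (-13, -1, -1, 1, [0, 1, 2, 6, 13, 14]),
      (-12, -2, -2, 0, [0, 1, 6, 7, 11, 12, 13]), (-12, -2, 2, 0, [0, 1, 2, 4, 5, 6, 7]),
      (-12, 0, 0, 0, [0, 1, 2, 3, 4, 5, 6, 7, 8, 9, 11, 13, 14]),
      (-12, 0, 4, 0, [0, 1, 2, 4, 5, 6, 7, 8, 9, 10, 12, 13]),
      (-12, 0, 8, 0, [1, 2, 4, 5, 8, 10, 12]), (-12, 2, -2, 0, [0, 3, 8, 9, 14]),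
      (-12, 2, 2, 0, [1, 2, 3, 8, 10, 13]), (-12, 2, 6, 0, [1, 2, 3, 8, 10]),
      (-11, -1, -1, -1, [0, 1, 2, 7, 12, 13, 14]),
      (-11, -1, 1, 1, [1, 2, 4, 5, 6, 7, 9, 10, 11]),
      (-11, -1, 3, -1, [1, 3, 4, 5, 12, 13, 14]), (-11, 1, -1, 1, [0, 1, 3, 9, 10, 11]),
      (-11, 1, 1, -1, [1, 3, 12, 14]), (-11, 1, 3, 1, [1, 2, 6, 8, 9, 10]),
      (-10, 0, 0, -2, [0, 1, 3, 5, 13, 14]), (-10, 0, 0, 2, [1, 2, 6, 8, 9, 10, 11]),
      (-10, 0, 4, -2, [1, 2, 3, 5, 13]), (-10, 0, 4, 2, [1, 2, 6, 8, 9, 10]),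
      (-9, -1, -1, -3, [0, 1, 2, 4, 5, 7, 11, 13]), (-9, -1, 1, 3, [0, 1, 2, 4, 6, 7, 9]),
      (-9, -1, 3, -3, [0, 1, 3, 4, 5, 7, 12, 13, 14]), (-9, -1, 7, -3, [1, 2, 3, 4, 5, 12, 13]),
      (-9, 1, -7, -3, [0, 3, 14]), (-9, 1, -5, 3, [0, 6, 8, 11]),
      (-9, 1, -3, -3, [0, 3, 5, 14]), (-9, 1, -1, 3, [0, 1, 6, 8, 9, 10, 11]),
      (-9, 1, 1, -3, [0, 1, 3, 5, 13, 14]), (-9, 1, 3, 3, [1, 2, 6, 8, 9, 10]),
      (-9, 1, 5, -3, [0, 1, 2, 3, 5, 10, 13]), (-9, 1, 7, 3, [1, 2, 8, 9, 10]),
      (-8, -2, 4, 2, [1, 2, 4, 6, 12]), (-8, 0, 0, 4, [0, 1, 6, 8, 9, 10, 11]),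
      (-8, 0, 2, -2, [1, 2, 3, 5, 7, 11]), (-8, 0, 2, 2, [1, 6, 8, 12, 13, 14]),
      (-8, 0, 6, -2, [1, 2, 4, 5, 9, 10, 11]), (-8, 2, 4, -2, [1, 2, 3, 9, 10]),
      (-7, -1, -7, 1, [0, 14]), (-7, -1, -1, -1, [0, 1, 4, 5, 6, 7, 9, 11]),
      (-7, -1, 1, 1, [0, 1, 4, 6, 7, 8, 13]), (-7, -1, 3, -1, [1, 3, 4, 5, 6, 7, 9]),
      (-7, -1, 5, 1, [2, 4, 6, 12, 13]), (-7, 1, -3, -1, [0, 1, 3]),
      (-7, 1, -1, 1, [0, 1, 8, 13, 14]), (-7, 1, 1, -1, [0, 3, 5, 8, 9, 10]),
      (-7, 1, 3, 1, [1, 8, 13]), (-7, 1, 5, -1, [1, 2, 5, 8, 9, 10]),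
      (-6, -2, -4, 0, [0, 1, 4, 5, 7, 11]), (-6, -2, 4, 0, [1, 2, 4, 5, 6, 7, 12, 13]),
      (-6, -2, 8, 0, [1, 2, 4, 5, 6, 7, 12]), (-6, 0, -6, 0, [0, 1, 3, 7, 8, 11, 14]),
      (-6, 0, -2, 0, [0, 1, 3, 4, 5, 6, 7, 11, 13, 14]),
      (-6, 0, 2, 0, [0, 1, 2, 3, 4, 5, 6, 7, 8, 9, 11, 13, 14]),
      (-6, 0, 6, 0, [1, 2, 3, 4, 5, 6, 8, 9, 10, 13]), (-6, 0, 10, 0, [2, 6, 8, 10, 12]),
      (-6, 2, -4, 0, [0, 3]), (-6, 2, 0, 0, [0, 1, 2, 3, 8, 14]),
      (-6, 2, 4, 0, [1, 3, 8, 9, 10]), (-5, -1, -7, -1, [0, 1, 14]),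
      (-5, -1, -5, 1, [0, 1, 6, 7, 9, 11]), (-5, -1, -1, 1, [0, 1, 4, 6, 7, 9, 10, 11]),
      (-5, -1, 1, -1, [0, 1, 5, 7, 12, 13, 14]), (-5, -1, 3, 1, [2, 4, 5, 6, 7, 9, 10, 11]),
      (-5, -1, 5, -1, [1, 2, 4, 5, 12]), (-5, 1, -3, 1, [0, 1, 6, 8, 9, 11]),
      (-5, 1, 1, 1, [0, 1, 3, 8, 10, 11]), (-5, 1, 3, -1, [3, 5, 13, 14]),
      (-5, 1, 5, 1, [1, 2, 3, 8, 9, 10]), (-4, -2, 0, -2, [0, 4, 5, 7, 13]),
      (-4, -2, 4, 2, [2, 4, 6, 9]), (-4, -2, 8, -2, [2, 4, 5, 12, 13]),
      (-4, 0, -6, 2, [0, 9, 11]), (-4, 0, -2, -2, [0, 3, 13, 14]),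
      (-4, 0, -2, 2, [0, 6, 7, 9, 11]), (-4, 0, 0, -4, [0, 1, 3, 5]),
      (-4, 0, 2, -2, [3, 13, 14]), (-4, 0, 2, 2, [2, 4, 6, 7, 8, 9, 10, 11]),
      (-4, 0, 4, -4, [2, 3, 5]), (-4, 0, 6, -2, [2, 3, 5, 12, 13]), (-4, 2, 0, 2, [8, 9]),
      (-4, 2, 4, 2, [2, 8, 9, 10]), (-3, -1, -7, -3, [0, 3, 11, 13, 14]),
      (-3, -1, -5, 3, [0, 6, 7, 8, 9, 11]), (-3, -1, -1, 3, [0, 4, 6, 7, 8, 9, 11]),
      (-3, -1, 1, -3, [0, 1, 3, 4, 5, 7, 11, 13, 14]), (-3, -1, 3, 3, [1, 4, 6, 7, 8, 10]),
      (-3, -1, 5, -3, [1, 2, 3, 4, 5, 7, 12, 13]), (-3, -1, 7, 3, [2, 4, 6, 8, 12]),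
      (-3, -1, 9, -3, [2, 4, 5, 7, 12]), (-3, 1, -3, 3, [0, 1, 8, 9, 14]),
      (-3, 1, -1, -3, [0, 3, 11, 13, 14]), (-3, 1, 1, 3, [0, 1, 6, 8, 9, 10]),
      (-3, 1, 3, -3, [0, 3, 5, 10]), (-3, 1, 5, 3, [1, 2, 6, 8, 9, 10]),
      (-3, 1, 7, -3, [1, 2, 3, 5]), (-3, 1, 11, -3, [2, 10]), (-2, -2, -2, 2, [0, 6, 7]),
      (-2, 0, -4, -2, [0, 3, 7, 11]), (-2, 0, 0, -2, [0, 1, 3, 4, 5, 9, 11]),
      (-2, 0, 0, 2, [0, 6, 7, 8, 14]), (-2, 0, 2, 4, [6, 8, 11]),
      (-2, 0, 4, -2, [3, 5, 10, 11]), (-2, 0, 4, 2, [2, 4, 6, 8, 12]),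
      (-2, 0, 6, 4, [2, 6, 8, 10]), (-2, 2, -2, -2, [0, 3, 11]), (-2, 2, 2, 2, [8, 14]),
      (-1, -1, -1, 1, [6, 8, 14]), (-1, -1, 1, -1, [1, 2, 4, 5, 7, 9, 11]),
      (-1, -1, 3, 1, [5, 6, 7, 8, 12, 13]), (-1, -1, 5, -1, [2, 4, 5, 6, 7, 9]),
      (-1, -1, 7, 1, [2, 4, 8, 12]), (-1, 1, -1, -1, [0, 3, 5, 8, 11]),
      (-1, 1, 3, -1, [2, 3, 6]), (-1, 1, 5, 1, [2, 8, 13]), (-1, 1, 7, -1, [8, 9, 10]),
      (0, -2, -6, 0, [0, 7, 11]), (0, -2, -2, 0, [0, 4, 6, 7, 11]),
      (0, -2, 2, 0, [0, 2, 4, 5, 6, 7, 8, 9, 10]), (0, -2, 6, 0, [1, 2, 4, 5, 6, 7, 12]),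
      (0, 0, -4, 0, [0, 1, 4, 14]), (0, 0, 0, 0, [0, 1, 2, 3, 5, 6, 7, 8, 9, 10, 11]),
      (0, 0, 4, 0, [1, 2, 3, 4, 5, 6, 7, 8, 10, 12]), (0, 0, 8, 0, [2, 4, 5, 6, 8, 10, 12]),
      (0, 2, -6, 0, [0, 14]), (0, 2, 2, 0, [0, 3, 6, 8, 10]), (0, 2, 6, 0, [2, 3, 8]),
      (1, -1, -3, 1, [7, 11]), (1, -1, -1, -1, [0, 2, 5, 7, 12, 14]),
      (1, -1, 1, 1, [1, 2, 4, 5, 6, 7, 9, 10, 11]), (1, -1, 3, -1, [3, 4, 5, 7, 12, 14]),
      (1, -1, 5, 1, [2, 4, 6, 7, 10]), (1, -1, 7, -1, [2, 4, 5, 12]),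
      (1, 1, -1, 1, [0, 3, 10, 11]), (1, 1, 1, -1, [3, 14]), (1, 1, 3, 1, [2, 6, 8, 10, 11]),
      (1, 1, 5, -1, [2, 3, 12]), (1, 1, 7, 1, [2, 8, 10]), (2, -2, -2, -2, [7, 12]),
      (2, -2, -2, 2, [4, 6, 7, 8]), (2, -2, 2, -2, [4, 5, 7]), (2, -2, 6, -2, [4, 12, 13]),
      (2, 0, -4, 2, [6, 7, 8, 9, 11]), (2, 0, -2, -4, [3, 5]), (2, 0, 0, -2, [3, 5, 13, 14]),
      (2, 0, 0, 2, [4, 8, 9, 10, 11]), (2, 0, 2, 4, [6, 8]), (2, 0, 4, -2, [5, 12, 13]),
      (2, 0, 4, 2, [6, 8, 9, 10]), (2, 0, 6, -4, [2, 4, 5]), (2, 2, -2, 2, [8]),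
      (2, 2, 4, -4, [3]), (3, -3, 1, -3, [0, 4, 5, 7]), (3, -1, -1, -3, [0, 3, 5, 7]),
      (3, -1, 1, 3, [4, 6, 7, 8, 9]), (3, -1, 3, -3, [2, 3, 4, 5, 7]),
      (3, -1, 5, 3, [4, 6, 7, 8]), (3, -1, 7, -3, [1, 2, 3, 4, 5, 7]), (3, 1, -1, 3, [0, 6, 8]),
      (3, 1, 1, -3, [0, 3, 5, 7]), (3, 1, 3, 3, [2, 6, 8]), (3, 1, 5, -3, [3, 4, 5, 10]),
      (3, 1, 7, 3, [2, 6, 8]), (3, 1, 9, -3, [5]), (3, 3, 3, -3, [3]), (4, -2, 4, 2, [4, 6, 7]),
      (4, 0, -2, 2, [6, 14]), (4, 0, 0, 4, [6, 8, 11]), (4, 0, 2, -2, [5, 7, 10, 11]),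
      (4, 0, 2, 2, [8, 12]), (4, 0, 6, -2, [2, 4, 5, 10]), (4, 0, 6, 2, [8, 12]),
      (4, 2, 4, -2, [3]), (5, -3, -3, -1, [4, 7, 11]), (5, -1, -5, -1, [0, 7, 11]),
      (5, -1, -1, -1, [4, 6]), (5, -1, 1, 1, [4, 7]), (5, -1, 3, -1, [7]), (5, 1, -3, -1, []),
      (5, 1, -1, 1, []), (5, 1, 3, 1, []), (5, 1, 5, -1, [10]), (6, -2, -4, 0, [4, 6, 7, 11]),
      (6, -2, 0, 0, [0, 4, 6, 7]), (6, -2, 4, 0, [4, 5, 6, 7]), (6, -2, 8, 0, [4, 8]),
      (6, 0, -6, 0, [0]), (6, 0, -2, 0, [0, 5, 7, 8]), (6, 0, 2, 0, [2, 3, 4, 5, 7, 8]),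
      (6, 0, 6, 0, [2, 4, 5, 6, 7, 8, 10]), (6, 2, 0, 0, [3]), (6, 2, 4, 0, [3]),
      (6, 2, 8, 0, [8]), (7, -1, -7, -1, []), (7, -1, -5, 1, [0, 7, 11]),
      (7, -1, -1, 1, [4, 6, 7, 11]), (7, -1, 1, -1, [4, 12, 14]), (7, -1, 5, -1, [12]),
      (7, 1, -3, 1, []), (7, 1, -1, -1, [14]), (7, 1, 1, 1, [8, 10]), (7, 1, 5, 1, [10]),
      (8, 0, 0, -4, [3]), (9, -3, 7, -3, [4, 5]), (9, -1, -3, -3, [5]), (9, -1, 1, -3, [0, 5]),
      (9, -1, 3, 3, [4, 6, 7]), (9, -1, 5, -3, [3, 5, 7]), (9, 1, -3, 3, [8]),
      (9, 1, 1, 3, [8]), (9, 1, 5, 3, [8]), (9, 1, 7, -3, []), (10, -2, 2, -2, [4, 5, 11]),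
      (10, 0, 0, -2, [3]), (11, -1, 1, -1, []), (12, -2, 6, 0, [4, 6]), (12, 0, -4, 0, []),
      (12, 0, 0, 0, []), (12, 0, 4, 0, []), (13, -1, 1, 1, []), (15, -1, 7, -3, [])]"

text \<open>A propositional check. The wheel has a monochromatic triple, and its vertices
  \<open>\<omega>\<close> and -1 share a second colour.\<close>

lemma wheel_core_uncolourable:
  fixes g :: "int \<Rightarrow> int \<Rightarrow> int \<Rightarrow> int \<Rightarrow> nat"
  assumes col: "\<And>a b c d. palette k0 k1 k2 k3 (g a b c d)"
    and edge: "\<And>a b c d a' b' c' d'. (a', b', c', d') \<in> set unit_vectors \<Longrightarrow>
      g a b c d \<noteq> g (a + a') (b + b') (c + c') (d + d')"
    and wheel: "g 0 0 0 0 = k0" "g 12 0 0 0 = k1" "g (-6) 0 6 0 = k1" "g (-6) 0 (-6) 0 = k1"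
      "g 6 0 6 0 = k2" "g (-12) 0 0 0 = k2"
  shows False
proof -
  have c: "list_all (\<lambda>(a, b, c, d, is). palette k0 k1 k2 k3 (g a b c d)) wheel_core"
    by (simp add: list_all_iff split_def col)
  have step: "apart k0 k1 k2 k3 (g a b c d) (g (a + a') (b + b') (c + c') (d + d'))"
    if "i < length unit_vectors" "unit_vectors ! i = (a', b', c', d')" for a b c d a' b' c' d' i
    using nth_mem[OF that(1)] that(2) by (simp add: apartI edge)
  \<comment> \<open>Since \<open>edge\<close> covers all integer quadruples, every index within
    bounds yields a valid constraint.\<close>
  have "list_all (\<lambda>(a, b, c, d, is). list_all (\<lambda>i. i < length unit_vectors) is) wheel_core"
    by (simp add: wheel_core_def unit_vectors_def)
  hence e: "list_all (\<lambda>(a, b, c, d, is). list_all (\<lambda>i. case unit_vectors ! i of (a', b', c', d') \<Rightarrow>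
      apart k0 k1 k2 k3 (g a b c d) (g (a + a') (b + b') (c + c') (d + d'))) is) wheel_core"
    by (rule list.pred_mono_strong) (auto intro: step elim!: list.pred_mono_strong)
  note c' = c[unfolded wheel_core_def, simplified, unfolded palette_def]
  note e' = e[unfolded wheel_core_def unit_vectors_def, simplified, unfolded apart_def]
  show False
    using wheel c' e' by sat
qed

section \<open>Hexagons with a monochromatic triple\<close>

lemma no_mono_triple:
  assumes f: "proper4 f" and u: "cmod u = 1"
  shows "\<not> mono_triple f p u"
proof
  assume T: "mono_triple f p u"
  define h where "h z = f (p + u * z)" for z
  have h4: "h z < 4" for z
    using f by (simp add: h_def proper4_def)
  have hne: "h z \<noteq> h w" if "cmod (z - w) = 1" for z w
    unfolding h_def using f u that by (rule proper4_isometry)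
  have tri: "h 1 = h (\<omega> - 1)" "h 1 = h (- \<omega>)"
    using T by (simp_all add: mono_triple_def h_def algebra_simps)
  \<comment> \<open>Multiplication by \<open>z\<close> preserves the triple and carries
    \<open>\<omega>\<close>, -1 to each pair of the other three vertices, so one standard wheel
    suffices.\<close>
  have no_repeat: "h (z * \<omega>) \<noteq> h (- z)" if z: "z = 1 \<or> z = \<omega> - 1 \<or> z = - \<omega>" for z
  proof
    assume eq: "h (z * \<omega>) = h (- z)"
    define g where "g a b c d = h (z * field_point a b c d)" for a b c d
    have cz: "cmod z = 1"
      using z cmod_omega by auto
    have ne: "h 0 \<noteq> h z" "h 0 \<noteq> h (- z)" "h z \<noteq> h (z * \<omega>)"
      using cz hne[of 0 z] hne[of 0 "- z"] hne[of z "z * \<omega>"]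
      by (simp_all add: norm_mult cmod_omega flip: right_diff_distrib[of z 1, simplified])
    \<comment> \<open>\<open>z\<close> and \<open>- z\<close> are not adjacent; their colours differ
      because \<open>- z\<close> shares its colour with \<open>z * \<omega>\<close>, a neighbour of
      \<open>z\<close>.\<close>
    obtain k where k: "\<And>i. i < 4 \<Longrightarrow> i = h 0 \<or> i = h z \<or> i = h (- z) \<or> i = k"
      using fourth_colour[OF h4 h4 h4 ne(1,2)] ne(3) eq by metis
    have pts: "field_point 0 0 0 0 = 0" "field_point 12 0 0 0 = 1" "field_point (-12) 0 0 0 = -1"
      "field_point 6 0 6 0 = \<omega>" "field_point (-6) 0 6 0 = \<omega> - 1" "field_point (-6) 0 (-6) 0 = - \<omega>"
      by (simp_all add: field_point_def \<omega>_def complex_eq_iff)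
    have tri_z: "h (z * (\<omega> - 1)) = h z" "h (- (z * \<omega>)) = h z"
      using z tri by (elim disjE; hypsubst; simp add: algebra_simps omega_square)+
    show False
    proof (rule wheel_core_uncolourable[of "h 0" "h z" "h (- z)" k g])
      show "palette (h 0) (h z) (h (- z)) k (g a b c d)" for a b c d
        using k[OF h4] by (simp add: palette_def g_def)
      show "g a b c d \<noteq> g (a + a') (b + b') (c + c') (d + d')"
        if "(a', b', c', d') \<in> set unit_vectors" for a b c d a' b' c' d'
      proof -
        have "cmod (field_point a' b' c' d') = 1"
          using that by (auto simp: unit_vectors_def intro!: cmod_field_point)
        moreover have "z * field_point a b c d - z * field_point (a + a') (b + b') (c + c') (d + d') =
            - (z * field_point a' b' c' d')"
          by (simp add: field_point_def complex_eq_iff field_simps)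
        ultimately show ?thesis
          unfolding g_def by (intro hne) (simp add: norm_mult cz)
      qed
    qed (simp_all add: g_def pts eq tri_z)
  qed
  \<comment> \<open>Each of these vertices is adjacent to the centre and to a member of the
    triple.\<close>
  have other: "h z \<noteq> h 0 \<and> h z \<noteq> h 1" if "z \<in> {\<omega>, -1, 1 - \<omega>}" for z
    using that hne[of z 0] hne[of z 1] hne[of z "\<omega> - 1"] tri cmod_omega
    by (auto simp: norm_minus_commute)
  have "h \<omega> \<noteq> h (-1)" "h (-1) \<noteq> h (1 - \<omega>)" "h (1 - \<omega>) \<noteq> h \<omega>"
    using no_repeat[of 1] no_repeat[of "\<omega> - 1"] no_repeat[of "- \<omega>"]
    by (simp_all add: algebra_simps omega_square)
  moreover have "h \<omega> \<noteq> h 0" "h \<omega> \<noteq> h 1" "h (-1) \<noteq> h 0" "h (-1) \<noteq> h 1"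
    "h (1 - \<omega>) \<noteq> h 0" "h (1 - \<omega>) \<noteq> h 1"
    using other by auto
  moreover have "h 0 \<noteq> h 1"
    by (rule hne) simp
  ultimately have "card {h 0, h 1, h \<omega>, h (-1), h (1 - \<omega>)} = 5"
    by simp
  moreover have "card {h 0, h 1, h \<omega>, h (-1), h (1 - \<omega>)} \<le> card {..<4::nat}"
    by (intro card_mono) (auto simp: h4)
  ultimately show False
    by simp
qed

section \<open>Transfer to the real plane\<close>

lemma plane_not_4_colourable: "\<not> unit_dist_colourable UNIV 4"
proof
  assume "unit_dist_colourable UNIV 4"
  then obtain c :: "real^2 \<Rightarrow> nat"
    where c: "\<And>p. c p < 4" "\<And>p q. dist p q = 1 \<Longrightarrow> c p \<noteq> c q"
    by (auto simp: unit_dist_colourable_def unit_dist_colouring_def)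
  have "dist (vector [Re z, Im z] :: real^2) (vector [Re w, Im w]) = cmod (z - w)" for z w
    by (simp add: dist_norm norm_vec_def L2_set_def cmod_def sum_2)
  hence "proper4 (\<lambda>z. c (vector [Re z, Im z]))"
    using c by (simp add: proper4_def)
  from exists_mono_triple[OF this] no_mono_triple[OF this] show False
    by blast
qed

theorem mainTheorem1:
  shows "(\<exists>P :: (real^2) set. finite P \<and> \<not> unit_dist_colourable P 4) \<and>
         (\<forall>c :: real^2 \<Rightarrow> nat. (\<forall>x. c x < 4) \<longrightarrow>
            (\<exists>x y. dist x y = 1 \<and> c x = c y))"
proof
  show "\<exists>P :: (real^2) set. finite P \<and> \<not> unit_dist_colourable P 4"
    using unit_dist_colourable_compactness plane_not_4_colourable by blast
  show "\<forall>c :: real^2 \<Rightarrow> nat. (\<forall>x. c x < 4) \<longrightarrow> (\<exists>x y. dist x y = 1 \<and> c x = c y)"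
    using plane_not_4_colourable by (auto simp: unit_dist_colourable_def unit_dist_colouring_def)
qed

end
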